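(* Let $L$ be either $\mathrm{RC}_1$ or $\mathrm{QRC}_1$. If $\varphi\vdash_L\psi$, then there is a formula $\chi$ in the common language of $\varphi$ and $\psi$ such that $\varphi\vdash_L\chi$ and $\chi\vdash_L\psi$.
   Context: Propositional strictly positive formulas: $\varphi ::= \top \mid p \mid (\varphi\wedge\varphi) \mid \Diamond\varphi$. $\mathrm{RC}_1$ derives sequents $\varphi\vdash\psi$ by: $\varphi\vdash\varphi$, $\varphi\vdash\top$; $\varphi\wedge\psi\vdash\varphi$, $\varphi\wedge\psi\vdash\psi$; from $\varphi\vdash\psi$ and $\varphi\vdash\chi$ infer $\varphi\vdash\psi\wedge\chi$; from $\varphi\vdash\psi$ and $\psi\vdash\chi$ infer $\varphi\vdash\chi$; from $\varphi\vdash\psi$ infer $\Diamond\varphi\vdash\Diamond\psi$; $\Diamond\Diamond\varphi\vdash\Diamond\varphi$. Quantified strictly positive formulas over a signature of relation symbols and constants (terms are variables or constants): $\varphi ::= \top \mid S(\mathbf{t}) \mid (\varphi\wedge\varphi) \mid \forall x\,\varphi \mid \Diamond\varphi$. $\mathrm{QRC}_1$ has the rules of $\mathrm{RC}_1$ (for these formulas) plus: from $\varphi\vdash\psi$ infer $\varphi\vdash\forall x\psi$ if $x$ not free in $\varphi$; from $\varphi[x\leftarrow t]\vdash\psi$ infer $\forall x\varphi\vdash\psi$, $t$ free for $x$ in $\varphi$; from $\varphi\vdash\psi$ infer $\varphi[x\leftarrow t]\vdash\psi[x\leftarrow t]$, $t$ free for $x$ in $\varphi,\psi$; from $\varphi[x\leftarrow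 c]\vdash\psi[x\leftarrow c]$ infer $\varphi\vdash\psi$ for a constant $c$ not in $\varphi,\psi$. The common language of $\varphi$ and $\psi$ consists of the non-logical symbols (propositional variables, resp. relation symbols and constants) occurring in both. *)

theory Defs
  imports Main
begin

section \<open>The propositional calculus\<close>

datatype 'p pfm =
    PTop
  | PVar 'p
  | PConj "'p pfm" "'p pfm"
  | PDia "'p pfm"

primrec pvars :: "'p pfm \<Rightarrow> 'p set" where
  "pvars PTop = {}"
| "pvars (PVar p) = {p}"
| "pvars (PConj \<phi> \<psi>) = pvars \<phi> \<union> pvars \<psi>"
| "pvars (PDia \<phi>) = pvars \<phi>"

inductive RC1 :: "'p pfm \<Rightarrow> 'p pfm \<Rightarrow> bool" (infix "\<turnstile>\<^sub>R\<^sub>C\<^sub>1" 50) where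
  refl: "\<phi> \<turnstile>\<^sub>R\<^sub>C\<^sub>1 \<phi>"
| top: "\<phi> \<turnstile>\<^sub>R\<^sub>C\<^sub>1 PTop"
| conjE1: "PConj \<phi> \<psi> \<turnstile>\<^sub>R\<^sub>C\<^sub>1 \<phi>"
| conjE2: "PConj \<phi> \<psi> \<turnstile>\<^sub>R\<^sub>C\<^sub>1 \<psi>"
| conjI: "\<phi> \<turnstile>\<^sub>R\<^sub>C\<^sub>1 \<psi> \<Longrightarrow> \<phi> \<turnstile>\<^sub>R\<^sub>C\<^sub>1 \<chi> \<Longrightarrow> \<phi> \<turnstile>\<^sub>R\<^sub>C\<^sub>1 PConj \<psi> \<chi>"
| cut: "\<phi> \<turnstile>\<^sub>R\<^sub>C\<^sub>1 \<psi> \<Longrightarrow> \<psi> \<turnstile>\<^sub>R\<^sub>C\<^sub>1 \<chi> \<Longrightarrow> \<phi> \<turnstile>\<^sub>R\<^sub>C\<^sub>1 \<chi>"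
| nec: "\<phi> \<turnstile>\<^sub>R\<^sub>C\<^sub>1 \<psi> \<Longrightarrow> PDia \<phi> \<turnstile>\<^sub>R\<^sub>C\<^sub>1 PDia \<psi>"
| trans: "PDia (PDia \<phi>) \<turnstile>\<^sub>R\<^sub>C\<^sub>1 PDia \<phi>"


section \<open>The quantified calculus\<close>

text \<open>Carrier sets, rather than whole types, are used for the symbols so that a
  signature may lack constants (or relation symbols) altogether.\<close>

record ('r, 'c) signature =
  rel_syms :: "'r set"
  const_syms :: "'c set"
  arity :: "'r \<Rightarrow> nat"

datatype 'c tm = Var nat | Const 'c

datatype ('r, 'c) fm =
    Top
  | Rel 'r "'c tm list"
  | Conj "('r, 'c) fm" "('r, 'c) fm"
  | All nat "('r, 'c) fm"
  | Dia "('r, 'c) fm"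

primrec tm_vars :: "'c tm \<Rightarrow> nat set" where
  "tm_vars (Var x) = {x}"
| "tm_vars (Const c) = {}"

primrec tm_consts :: "'c tm \<Rightarrow> 'c set" where
  "tm_consts (Var x) = {}"
| "tm_consts (Const c) = {c}"

primrec fv :: "('r, 'c) fm \<Rightarrow> nat set" where
  "fv Top = {}"
| "fv (Rel S ts) = (\<Union>t\<in>set ts. tm_vars t)"
| "fv (Conj \<phi> \<psi>) = fv \<phi> \<union> fv \<psi>"
| "fv (All x \<phi>) = fv \<phi> - {x}"
| "fv (Dia \<phi>) = fv \<phi>"

primrec rels_of :: "('r, 'c) fm \<Rightarrow> 'r set" where
  "rels_of Top = {}"
| "rels_of (Rel S ts) = {S}"
| "rels_of (Conj \<phi> \<psi>) = rels_of \<phi> \<union> rels_of \<psi>"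
| "rels_of (All x \<phi>) = rels_of \<phi>"
| "rels_of (Dia \<phi>) = rels_of \<phi>"

primrec consts_of :: "('r, 'c) fm \<Rightarrow> 'c set" where
  "consts_of Top = {}"
| "consts_of (Rel S ts) = (\<Union>t\<in>set ts. tm_consts t)"
| "consts_of (Conj \<phi> \<psi>) = consts_of \<phi> \<union> consts_of \<psi>"
| "consts_of (All x \<phi>) = consts_of \<phi>"
| "consts_of (Dia \<phi>) = consts_of \<phi>"

definition is_tm :: "('r, 'c) signature \<Rightarrow> 'c tm \<Rightarrow> bool" where
  "is_tm \<Sigma> t \<longleftrightarrow> tm_consts t \<subseteq> const_syms \<Sigma>"

primrec is_fm :: "('r, 'c) signature \<Rightarrow> ('r, 'c) fm \<Rightarrow> bool" where
  "is_fm \<Sigma> Top \<longleftrightarrow> True"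
| "is_fm \<Sigma> (Rel S ts) \<longleftrightarrow>
     S \<in> rel_syms \<Sigma> \<and> length ts = arity \<Sigma> S \<and> (\<forall>t\<in>set ts. is_tm \<Sigma> t)"
| "is_fm \<Sigma> (Conj \<phi> \<psi>) \<longleftrightarrow> is_fm \<Sigma> \<phi> \<and> is_fm \<Sigma> \<psi>"
| "is_fm \<Sigma> (All x \<phi>) \<longleftrightarrow> is_fm \<Sigma> \<phi>"
| "is_fm \<Sigma> (Dia \<phi>) \<longleftrightarrow> is_fm \<Sigma> \<phi>"

primrec subst_tm :: "nat \<Rightarrow> 'c tm \<Rightarrow> 'c tm \<Rightarrow> 'c tm" where
  "subst_tm x t (Var y) = (if y = x then t else Var y)"
| "subst_tm x t (Const c) = Const c"

text \<open>\<open>subst x t \<phi>\<close> replaces the free occurrences of \<open>x\<close> without renaming bound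
  variables; capture is excluded by \<open>free_for t x \<phi>\<close>, i.e. no free occurrence of
  \<open>x\<close> in \<open>\<phi>\<close> lies in the scope of a quantifier binding a variable of \<open>t\<close>.\<close>

primrec subst :: "nat \<Rightarrow> 'c tm \<Rightarrow> ('r, 'c) fm \<Rightarrow> ('r, 'c) fm" where
  "subst x t Top = Top"
| "subst x t (Rel S ts) = Rel S (map (subst_tm x t) ts)"
| "subst x t (Conj \<phi> \<psi>) = Conj (subst x t \<phi>) (subst x t \<psi>)"
| "subst x t (All y \<phi>) = All y (if y = x then \<phi> else subst x t \<phi>)"
| "subst x t (Dia \<phi>) = Dia (subst x t \<phi>)"

primrec free_for :: "'c tm \<Rightarrow> nat \<Rightarrow> ('r, 'c) fm \<Rightarrow> bool" where
  "free_for t x Top \<longleftrightarrow> True"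
| "free_for t x (Rel S ts) \<longleftrightarrow> True"
| "free_for t x (Conj \<phi> \<psi>) \<longleftrightarrow> free_for t x \<phi> \<and> free_for t x \<psi>"
| "free_for t x (All y \<phi>) \<longleftrightarrow>
     x \<notin> fv (All y \<phi>) \<or> (y \<notin> tm_vars t \<and> free_for t x \<phi>)"
| "free_for t x (Dia \<phi>) \<longleftrightarrow> free_for t x \<phi>"

text \<open>The side conditions \<open>is_fm\<close> and \<open>is_tm\<close> only ensure that derivations stay
  inside the language of \<open>\<Sigma>\<close>; where a rule omits them, they follow from its premises.\<close>

inductive QRC1 :: "('r, 'c) signature \<Rightarrow> ('r, 'c) fm \<Rightarrow> ('r, 'c) fm \<Rightarrow> bool"
    ("_ : _ \<turnstile>\<^sub>Q\<^sub>R\<^sub>C\<^sub>1 _" [51, 51, 51] 50)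
  for \<Sigma> :: "('r, 'c) signature" where
  refl: "is_fm \<Sigma> \<phi> \<Longrightarrow> \<Sigma> : \<phi> \<turnstile>\<^sub>Q\<^sub>R\<^sub>C\<^sub>1 \<phi>"
| top: "is_fm \<Sigma> \<phi> \<Longrightarrow> \<Sigma> : \<phi> \<turnstile>\<^sub>Q\<^sub>R\<^sub>C\<^sub>1 Top"
| conjE1: "is_fm \<Sigma> \<phi> \<Longrightarrow> is_fm \<Sigma> \<psi> \<Longrightarrow> \<Sigma> : Conj \<phi> \<psi> \<turnstile>\<^sub>Q\<^sub>R\<^sub>C\<^sub>1 \<phi>"
| conjE2: "is_fm \<Sigma> \<phi> \<Longrightarrow> is_fm \<Sigma> \<psi> \<Longrightarrow> \<Sigma> : Conj \<phi> \<psi> \<turnstile>\<^sub>Q\<^sub>R\<^sub>C\<^sub>1 \<psi>"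
| conjI: "\<Sigma> : \<phi> \<turnstile>\<^sub>Q\<^sub>R\<^sub>C\<^sub>1 \<psi> \<Longrightarrow> \<Sigma> : \<phi> \<turnstile>\<^sub>Q\<^sub>R\<^sub>C\<^sub>1 \<chi> \<Longrightarrow> \<Sigma> : \<phi> \<turnstile>\<^sub>Q\<^sub>R\<^sub>C\<^sub>1 Conj \<psi> \<chi>"
| cut: "\<Sigma> : \<phi> \<turnstile>\<^sub>Q\<^sub>R\<^sub>C\<^sub>1 \<psi> \<Longrightarrow> \<Sigma> : \<psi> \<turnstile>\<^sub>Q\<^sub>R\<^sub>C\<^sub>1 \<chi> \<Longrightarrow> \<Sigma> : \<phi> \<turnstile>\<^sub>Q\<^sub>R\<^sub>C\<^sub>1 \<chi>"
| nec: "\<Sigma> : \<phi> \<turnstile>\<^sub>Q\<^sub>R\<^sub>C\<^sub>1 \<psi> \<Longrightarrow> \<Sigma> : Dia \<phi> \<turnstile>\<^sub>Q\<^sub>R\<^sub>C\<^sub>1 Dia \<psi>"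
| trans: "is_fm \<Sigma> \<phi> \<Longrightarrow> \<Sigma> : Dia (Dia \<phi>) \<turnstile>\<^sub>Q\<^sub>R\<^sub>C\<^sub>1 Dia \<phi>"
| allR: "\<Sigma> : \<phi> \<turnstile>\<^sub>Q\<^sub>R\<^sub>C\<^sub>1 \<psi> \<Longrightarrow> x \<notin> fv \<phi> \<Longrightarrow> \<Sigma> : \<phi> \<turnstile>\<^sub>Q\<^sub>R\<^sub>C\<^sub>1 All x \<psi>"
| allL: "\<Sigma> : subst x t \<phi> \<turnstile>\<^sub>Q\<^sub>R\<^sub>C\<^sub>1 \<psi> \<Longrightarrow> is_tm \<Sigma> t \<Longrightarrow> free_for t x \<phi> \<Longrightarrow>
    \<Sigma> : All x \<phi> \<turnstile>\<^sub>Q\<^sub>R\<^sub>C\<^sub>1 \<psi>"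
| inst: "\<Sigma> : \<phi> \<turnstile>\<^sub>Q\<^sub>R\<^sub>C\<^sub>1 \<psi> \<Longrightarrow> is_tm \<Sigma> t \<Longrightarrow> free_for t x \<phi> \<Longrightarrow> free_for t x \<psi> \<Longrightarrow>
    \<Sigma> : subst x t \<phi> \<turnstile>\<^sub>Q\<^sub>R\<^sub>C\<^sub>1 subst x t \<psi>"
| const: "\<Sigma> : subst x (Const c) \<phi> \<turnstile>\<^sub>Q\<^sub>R\<^sub>C\<^sub>1 subst x (Const c) \<psi> \<Longrightarrow> c \<in> const_syms \<Sigma> \<Longrightarrow>
    c \<notin> consts_of \<phi> \<Longrightarrow> c \<notin> consts_of \<psi> \<Longrightarrow> \<Sigma> : \<phi> \<turnstile>\<^sub>Q\<^sub>R\<^sub>C\<^sub>1 \<psi>"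

text \<open>Sanity check: derivable sequents consist of formulas over the signature.\<close>

lemma is_tm_subst_tmD: "is_tm \<Sigma> (subst_tm x t s) \<Longrightarrow> is_tm \<Sigma> s"
  by (cases s) (auto simp: is_tm_def)

lemma is_tm_subst_tm: "is_tm \<Sigma> s \<Longrightarrow> is_tm \<Sigma> t \<Longrightarrow> is_tm \<Sigma> (subst_tm x t s)"
  by (cases s) (auto simp: is_tm_def)

lemma is_fm_substD: "is_fm \<Sigma> (subst x t \<phi>) \<Longrightarrow> is_fm \<Sigma> \<phi>"
  by (induction \<phi>) (auto dest: is_tm_subst_tmD split: if_splits)

lemma is_fm_subst: "is_fm \<Sigma> \<phi> \<Longrightarrow> is_tm \<Sigma> t \<Longrightarrow> is_fm \<Sigma> (subst x t \<phi>)"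
  by (induction \<phi>) (auto intro: is_tm_subst_tm)

lemma QRC1_is_fm: "\<Sigma> : \<phi> \<turnstile>\<^sub>Q\<^sub>R\<^sub>C\<^sub>1 \<psi> \<Longrightarrow> is_fm \<Sigma> \<phi> \<and> is_fm \<Sigma> \<psi>"
  by (induction rule: QRC1.induct) (auto dest: is_fm_substD intro: is_fm_subst)

end

theory Submission
  imports Defs
begin

text \<open>Strictly positive formulas have neither disjunction nor implication, so no propositional
  variable or relation symbol can be introduced on the right: in \<open>RC\<^sub>1\<close> the succedent itself
  interpolates. In \<open>QRC\<^sub>1\<close> only constants can be new in the succedent \<open>\<psi>\<close>, through instantiation
  of universal quantifiers. A constant absent from the antecedent is generic, hence it may be
  replaced by a fresh variable and universally quantified, which gives a formula that
  still implies \<open>\<psi>\<close>; doing so for each such constant yields the interpolant.\<close>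

lemma RC1_pvars_subset: "\<phi> \<turnstile>\<^sub>R\<^sub>C\<^sub>1 \<psi> \<Longrightarrow> pvars \<psi> \<subseteq> pvars \<phi>"
  by (induction rule: RC1.induct) auto

lemma rels_of_subst [simp]: "rels_of (subst x t \<phi>) = rels_of \<phi>"
  by (induction \<phi>) auto

text \<open>Each rule preserves the inclusion, as substitution leaves relation symbols untouched.
  The analogue for constants fails: \<open>All x \<phi>\<close> derives
  \<open>subst x (Const c) \<phi>\<close> for any \<open>c\<close> of the signature.\<close>

lemma QRC1_rels_of_subset: "\<Sigma> : \<phi> \<turnstile>\<^sub>Q\<^sub>R\<^sub>C\<^sub>1 \<psi> \<Longrightarrow> rels_of \<psi> \<subseteq> rels_of \<phi>"
  by (induction rule: QRC1.induct) auto

text \<open>Binders are counted as well, even vacuous ones, so that a variable outside this set can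
  take the place of a constant without being captured.\<close>

primrec vars_of :: "('r, 'c) fm \<Rightarrow> nat set" where
  "vars_of Top = {}"
| "vars_of (Rel S ts) = (\<Union>t\<in>set ts. tm_vars t)"
| "vars_of (Conj \<phi> \<psi>) = vars_of \<phi> \<union> vars_of \<psi>"
| "vars_of (All x \<phi>) = insert x (vars_of \<phi>)"
| "vars_of (Dia \<phi>) = vars_of \<phi>"

lemma finite_tm_vars: "finite (tm_vars t)"
  by (cases t) auto

lemma finite_vars_of: "finite (vars_of \<phi>)"
  by (induction \<phi>) (auto simp: finite_tm_vars)

lemma finite_tm_consts: "finite (tm_consts t)"
  by (cases t) auto

lemma finite_consts_of: "finite (consts_of \<phi>)"
  by (induction \<phi>) (auto simp: finite_tm_consts)

lemma fv_subset_vars_of: "fv \<phi> \<subseteq> vars_of \<phi>"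
  by (induction \<phi>) auto

lemma subst_tm_not_in_vars: "x \<notin> tm_vars s \<Longrightarrow> subst_tm x t s = s"
  by (cases s) auto

lemma subst_not_in_vars: "x \<notin> vars_of \<phi> \<Longrightarrow> subst x t \<phi> = \<phi>"
  by (induction \<phi>) (auto simp: subst_tm_not_in_vars intro: map_idI)

lemma free_for_Const: "free_for (Const c) x \<phi>"
  by (induction \<phi>) auto

primrec abstract_tm :: "'c \<Rightarrow> nat \<Rightarrow> 'c tm \<Rightarrow> 'c tm" where
  "abstract_tm c y (Var x) = Var x"
| "abstract_tm c y (Const d) = (if d = c then Var y else Const d)"

primrec abstract :: "'c \<Rightarrow> nat \<Rightarrow> ('r, 'c) fm \<Rightarrow> ('r, 'c) fm" where
  "abstract c y Top = Top"
| "abstract c y (Rel S ts) = Rel S (map (abstract_tm c y) ts)"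
| "abstract c y (Conj \<phi> \<psi>) = Conj (abstract c y \<phi>) (abstract c y \<psi>)"
| "abstract c y (All x \<phi>) = All x (abstract c y \<phi>)"
| "abstract c y (Dia \<phi>) = Dia (abstract c y \<phi>)"

lemma subst_tm_abstract_tm: "y \<notin> tm_vars t \<Longrightarrow> subst_tm y (Const c) (abstract_tm c y t) = t"
  by (cases t) auto

text \<open>By freshness, every \<open>y\<close> in \<open>abstract c y \<phi>\<close> stands where
  \<open>c\<close> stood and no quantifier binds it, so substitution undoes the abstraction.\<close>

lemma subst_abstract: "y \<notin> vars_of \<phi> \<Longrightarrow> subst y (Const c) (abstract c y \<phi>) = \<phi>"
  by (induction \<phi>) (auto simp: subst_tm_abstract_tm intro: map_idI)

lemma tm_consts_abstract_tm: "tm_consts (abstract_tm c y t) = tm_consts t - {c}"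
  by (cases t) auto

lemma consts_of_abstract: "consts_of (abstract c y \<phi>) = consts_of \<phi> - {c}"
  by (induction \<phi>) (auto simp: tm_consts_abstract_tm)

lemma rels_of_abstract: "rels_of (abstract c y \<phi>) = rels_of \<phi>"
  by (induction \<phi>) auto

lemma is_fm_consts_of: "is_fm \<Sigma> \<phi> \<Longrightarrow> consts_of \<phi> \<subseteq> const_syms \<Sigma>"
  by (induction \<phi>) (auto simp: is_tm_def)

lemma QRC1_generalize_const:
  assumes "\<Sigma> : \<phi> \<turnstile>\<^sub>Q\<^sub>R\<^sub>C\<^sub>1 \<psi>" and "c \<in> const_syms \<Sigma>" and "c \<notin> consts_of \<phi>"
  obtains \<chi> where "rels_of \<chi> = rels_of \<psi>" and "consts_of \<chi> = consts_of \<psi> - {c}"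
    and "\<Sigma> : \<phi> \<turnstile>\<^sub>Q\<^sub>R\<^sub>C\<^sub>1 \<chi>" and "\<Sigma> : \<chi> \<turnstile>\<^sub>Q\<^sub>R\<^sub>C\<^sub>1 \<psi>"
proof -
  have "finite (vars_of \<phi> \<union> vars_of \<psi>)"
    by (simp add: finite_vars_of)
  \<comment> \<open>Freshness for \<open>\<phi>\<close> makes substitution for \<open>y\<close>
    trivial there and permits \<open>allR\<close>; freshness for \<open>\<psi>\<close> makes the
    abstraction reversible.\<close>
  then obtain y where y: "y \<notin> vars_of \<phi>" "y \<notin> vars_of \<psi>"
    using ex_new_if_finite[OF infinite_UNIV_nat, of "vars_of \<phi> \<union> vars_of \<psi>"] by auto
  let ?\<psi> = "abstract c y \<psi>"
  have inst: "subst y (Const c) ?\<psi> = \<psi>"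
    using y(2) by (rule subst_abstract)
  \<comment> \<open>Substituting \<open>c\<close> for \<open>y\<close> on both sides gives back the
    assumed sequent, and \<open>c\<close> occurs neither in \<open>\<phi>\<close> nor in
    \<open>?\<psi>\<close>, so \<open>const\<close> applies.\<close>
  have "\<Sigma> : \<phi> \<turnstile>\<^sub>Q\<^sub>R\<^sub>C\<^sub>1 ?\<psi>"
    by (rule QRC1.const[of \<Sigma> y c])
      (use assms y(1) inst in \<open>simp_all add: subst_not_in_vars consts_of_abstract\<close>)
  then have right: "\<Sigma> : \<phi> \<turnstile>\<^sub>Q\<^sub>R\<^sub>C\<^sub>1 All y ?\<psi>"
    by (rule QRC1.allR) (use y(1) fv_subset_vars_of[of \<phi>] in auto)
  \<comment> \<open>Instantiating the quantifier at \<open>c\<close> recovers \<open>\<psi>\<close>,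
    so reflexivity serves as the premise of \<open>allL\<close>.\<close>
  have "\<Sigma> : subst y (Const c) ?\<psi> \<turnstile>\<^sub>Q\<^sub>R\<^sub>C\<^sub>1 \<psi>"
    unfolding inst using QRC1_is_fm[OF assms(1)] by (simp add: QRC1.refl)
  then have left: "\<Sigma> : All y ?\<psi> \<turnstile>\<^sub>Q\<^sub>R\<^sub>C\<^sub>1 \<psi>"
    by (rule QRC1.allL[of \<Sigma> y "Const c"])
      (use assms(2) in \<open>simp_all add: is_tm_def free_for_Const\<close>)
  show thesis
    by (rule that[of "All y ?\<psi>"])
      (use right left in \<open>simp_all add: consts_of_abstract rels_of_abstract\<close>)
qed

text \<open>Induction on the number of constants of \<open>\<psi>\<close> foreign to
  \<open>\<phi>\<close>, with \<open>\<phi>\<close> fixed and one such constant generalized away at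
  each step.\<close>

lemma QRC1_interpolant:
  assumes "\<Sigma> : \<phi> \<turnstile>\<^sub>Q\<^sub>R\<^sub>C\<^sub>1 \<psi>"
  shows "\<exists>\<chi>. rels_of \<chi> \<subseteq> rels_of \<phi> \<inter> rels_of \<psi> \<and>
    consts_of \<chi> \<subseteq> consts_of \<phi> \<inter> consts_of \<psi> \<and>
    \<Sigma> : \<phi> \<turnstile>\<^sub>Q\<^sub>R\<^sub>C\<^sub>1 \<chi> \<and> \<Sigma> : \<chi> \<turnstile>\<^sub>Q\<^sub>R\<^sub>C\<^sub>1 \<psi>"
  using assms
proof (induction "card (consts_of \<psi> - consts_of \<phi>)" arbitrary: \<psi> rule: less_induct)
  case less
  show ?case
  proof (cases "consts_of \<psi> \<subseteq> consts_of \<phi>")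
    \<comment> \<open>With no foreign constant left, \<open>\<psi>\<close> is its own interpolant,
      its relation symbols all coming from \<open>\<phi>\<close>.\<close>
    case True
    have "\<Sigma> : \<psi> \<turnstile>\<^sub>Q\<^sub>R\<^sub>C\<^sub>1 \<psi>"
      using QRC1_is_fm[OF less.prems] by (simp add: QRC1.refl)
    then show ?thesis
      using True less.prems QRC1_rels_of_subset[OF less.prems] by (intro exI[of _ \<psi>]) simp
  next
    case False
    then obtain c where c: "c \<in> consts_of \<psi>" "c \<notin> consts_of \<phi>"
      by blast
    have "c \<in> const_syms \<Sigma>"
      using QRC1_is_fm[OF less.prems] is_fm_consts_of[of \<Sigma> \<psi>] c(1) by auto
    then obtain \<psi>' where \<psi>': "rels_of \<psi>' = rels_of \<psi>" "consts_of \<psi>' = consts_of \<psi> - {c}"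
        "\<Sigma> : \<phi> \<turnstile>\<^sub>Q\<^sub>R\<^sub>C\<^sub>1 \<psi>'" "\<Sigma> : \<psi>' \<turnstile>\<^sub>Q\<^sub>R\<^sub>C\<^sub>1 \<psi>"
      by (rule QRC1_generalize_const[OF less.prems _ c(2)])
    have "card (consts_of \<psi>' - consts_of \<phi>) < card (consts_of \<psi> - consts_of \<phi>)"
      using c \<psi>'(2) by (intro psubset_card_mono) (auto simp: finite_consts_of)
    from less.hyps[OF this \<psi>'(3)] obtain \<chi>
      where \<chi>: "rels_of \<chi> \<subseteq> rels_of \<phi> \<inter> rels_of \<psi>'"
        "consts_of \<chi> \<subseteq> consts_of \<phi> \<inter> consts_of \<psi>'"
        "\<Sigma> : \<phi> \<turnstile>\<^sub>Q\<^sub>R\<^sub>C\<^sub>1 \<chi>" "\<Sigma> : \<chi> \<turnstile>\<^sub>Q\<^sub>R\<^sub>C\<^sub>1 \<psi>'"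
      by auto
    \<comment> \<open>An interpolant for \<open>\<psi>'\<close> also serves \<open>\<psi>\<close>:
      \<open>\<psi>'\<close> derives \<open>\<psi>\<close> and brings in no new symbol.\<close>
    have "\<Sigma> : \<chi> \<turnstile>\<^sub>Q\<^sub>R\<^sub>C\<^sub>1 \<psi>"
      using \<chi>(4) \<psi>'(4) by (rule QRC1.cut)
    then show ?thesis
      using \<chi> \<psi>'(1,2) by (intro exI[of _ \<chi>]) auto
  qed
qed

theorem theorem8p1:
  shows "(\<forall>\<phi> \<psi> :: 'p pfm. \<phi> \<turnstile>\<^sub>R\<^sub>C\<^sub>1 \<psi> \<longrightarrow>
            (\<exists>\<chi>. pvars \<chi> \<subseteq> pvars \<phi> \<inter> pvars \<psi> \<and>
                 \<phi> \<turnstile>\<^sub>R\<^sub>C\<^sub>1 \<chi> \<and> \<chi> \<turnstile>\<^sub>R\<^sub>C\<^sub>1 \<psi>)) \<and>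
         (\<forall>(\<Sigma> :: ('r, 'c) signature) \<phi> \<psi>. \<Sigma> : \<phi> \<turnstile>\<^sub>Q\<^sub>R\<^sub>C\<^sub>1 \<psi> \<longrightarrow>
            (\<exists>\<chi>. rels_of \<chi> \<subseteq> rels_of \<phi> \<inter> rels_of \<psi> \<and>
                 consts_of \<chi> \<subseteq> consts_of \<phi> \<inter> consts_of \<psi> \<and>
                 \<Sigma> : \<phi> \<turnstile>\<^sub>Q\<^sub>R\<^sub>C\<^sub>1 \<chi> \<and> \<Sigma> : \<chi> \<turnstile>\<^sub>Q\<^sub>R\<^sub>C\<^sub>1 \<psi>))"
proof (intro HOL.conjI allI impI)
  fix \<phi> \<psi> :: "'p pfm"
  assume "\<phi> \<turnstile>\<^sub>R\<^sub>C\<^sub>1 \<psi>"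
  then show "\<exists>\<chi>. pvars \<chi> \<subseteq> pvars \<phi> \<inter> pvars \<psi> \<and> \<phi> \<turnstile>\<^sub>R\<^sub>C\<^sub>1 \<chi> \<and> \<chi> \<turnstile>\<^sub>R\<^sub>C\<^sub>1 \<psi>"
    using RC1_pvars_subset[of \<phi> \<psi>] by (intro exI[of _ \<psi>]) (simp add: RC1.refl)
next
  fix \<Sigma> :: "('r, 'c) signature" and \<phi> \<psi>
  assume "\<Sigma> : \<phi> \<turnstile>\<^sub>Q\<^sub>R\<^sub>C\<^sub>1 \<psi>"
  then show "\<exists>\<chi>. rels_of \<chi> \<subseteq> rels_of \<phi> \<inter> rels_of \<psi> \<and>
      consts_of \<chi> \<subseteq> consts_of \<phi> \<inter> consts_of \<psi> \<and> \<Sigma> : \<phi> \<turnstile>\<^sub>Q\<^sub>R\<^sub>C\<^sub>1 \<chi> \<and> \<Sigma> : \<chi> \<turnstile>\<^sub>Q\<^sub>R\<^sub>C\<^sub>1 \<psi>"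
    by (rule QRC1_interpolant)
qed

end
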